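(* Let $(A,B,C)$ be a bilinear algorithm for convolution of a vector in $\mathbb{R}^r$ with a vector in $\mathbb{R}^n$. Let $f\in\mathbb{R}^r$ and $g\in\mathbb{R}^n$, and let $\delta f$, $\delta g$ be perturbations with $\|\delta f\|\le\varepsilon\|f\|$ and $\|\delta g\|\le\varepsilon\|g\|$. Then the absolute error $\delta y$ of the bilinear algorithm satisfies $$\|\delta y\|\le 2\big(\|C\|\cdot\|A\|\cdot\|B\|\cdot\|f\|\cdot\|g\|\big)\,\varepsilon+O(\varepsilon^2),$$ where $\|\cdot\|$ is the 2-norm.
   Context: A bilinear algorithm $(A,B,C)$ with $A\in\mathbb{C}^{r\times R}$, $B\in\mathbb{C}^{n\times R}$ and $C$ a complex matrix with $R$ columns computes $y(f,g)=C\big[(A^{\mathsf T}f)\odot(B^{\mathsf T}g)\big]$, where $\odot$ is the entrywise product. The error caused by perturbing the inputs is $\delta y=y(f+\delta f,g+\delta g)-y(f,g)$. For vectors $\|\cdot\|$ is the Euclidean norm and for matrices it is the induced (spectral) norm. The $O(\varepsilon^2)$ term is as $\varepsilon\to0$, with a constant that may depend on $A,B,C,f,g$ but not on $\varepsilon,\delta f,\delta g$. *)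

theory Defs
  imports "HOL-Analysis.Analysis" "HOL-Library.Landau_Symbols"
begin

definition complex_vec :: "real ^ 'n \<Rightarrow> complex ^ 'n"
  where "complex_vec x = (\<chi> i. complex_of_real (x $ i))"

text \<open>An r-by-R matrix has type \<open>complex ^ 'R ^ 'r\<close>. On the vector types, \<open>*\<close> is the
  entrywise product and \<open>norm\<close> is the Euclidean norm.\<close>

definition bilinear_alg ::
  "complex ^ 'R ^ 'r \<Rightarrow> complex ^ 'R ^ 'n \<Rightarrow> complex ^ 'R ^ 'm \<Rightarrow>
     real ^ 'r \<Rightarrow> real ^ 'n \<Rightarrow> complex ^ 'm"
  where "bilinear_alg A B C f g =
    C *v ((transpose A *v complex_vec f) * (transpose B *v complex_vec g))"

definition bilinear_alg_error ::
  "complex ^ 'R ^ 'r \<Rightarrow> complex ^ 'R ^ 'n \<Rightarrow> complex ^ 'R ^ 'm \<Rightarrow>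
     real ^ 'r \<Rightarrow> real ^ 'n \<Rightarrow> real ^ 'r \<Rightarrow> real ^ 'n \<Rightarrow> complex ^ 'm"
  where "bilinear_alg_error A B C f g \<delta>f \<delta>g =
    bilinear_alg A B C (f + \<delta>f) (g + \<delta>g) - bilinear_alg A B C f g"

definition spectral_norm :: "complex ^ 'k ^ 'l \<Rightarrow> real"
  where "spectral_norm M = onorm (\<lambda>x. M *v x)"

text \<open>Vector entries are indexed by finite types, which carry no order. The positions
  \<open>0, 1, 2, \<dots>\<close> that convolution refers to are supplied by numberings of these types.\<close>

definition numbering :: "('i::finite \<Rightarrow> nat) \<Rightarrow> bool"
  where "numbering p \<longleftrightarrow> bij_betw p UNIV {..<CARD('i)}"

definition linear_convolution ::
  "('r::finite \<Rightarrow> nat) \<Rightarrow> ('n::finite \<Rightarrow> nat) \<Rightarrow> real ^ 'r \<Rightarrow> real ^ 'n \<Rightarrow> nat \<Rightarrow> real"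
  where "linear_convolution p q f g k =
    (\<Sum>(i, j) \<in> {(i, j). p i + q j = k}. f $ i * g $ j)"

definition cyclic_convolution ::
  "('r::finite \<Rightarrow> nat) \<Rightarrow> ('n::finite \<Rightarrow> nat) \<Rightarrow> real ^ 'r \<Rightarrow> real ^ 'n \<Rightarrow> nat \<Rightarrow> real"
  where "cyclic_convolution p q f g k =
    (\<Sum>(i, j) \<in> {(i, j). (p i + q j) mod CARD('n) = k}. f $ i * g $ j)"

text \<open>The unqualified word ``convolution'' admits both the linear one (with \<open>r + n - 1\<close> outputs)
  and, for inputs of equal length, the cyclic one.\<close>

definition bilinear_alg_for_convolution ::
  "('r::finite \<Rightarrow> nat) \<Rightarrow> ('n::finite \<Rightarrow> nat) \<Rightarrow> ('m::finite \<Rightarrow> nat) \<Rightarrow>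
     complex ^ 'R ^ 'r \<Rightarrow> complex ^ 'R ^ 'n \<Rightarrow> complex ^ 'R ^ 'm \<Rightarrow> bool"
  where "bilinear_alg_for_convolution p q s A B C \<longleftrightarrow>
    (CARD('m) = CARD('r) + CARD('n) - 1 \<and>
      (\<forall>f g k. bilinear_alg A B C f g $ k = complex_of_real (linear_convolution p q f g (s k)))) \<or>
    (CARD('r) = CARD('n) \<and> CARD('m) = CARD('n) \<and>
      (\<forall>f g k. bilinear_alg A B C f g $ k = complex_of_real (cyclic_convolution p q f g (s k))))"

end

theory Submission imports Defs begin

text \<open>The map computed by a bilinear algorithm is bilinear in \<open>(f, g)\<close>, so its error splits
  exactly as \<open>\<delta>y = y(f, \<delta>g) + y(\<delta>f, g) + y(\<delta>f, \<delta>g)\<close>.  Writing \<open>K = \<parallel>C\<parallel> \<parallel>A\<parallel> \<parallel>B\<parallel>\<close>, one has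
  \<open>\<parallel>y(f, g)\<parallel> \<le> K \<parallel>f\<parallel> \<parallel>g\<parallel>\<close> (lemma \<open>norm_bilinear_alg_le\<close>); the first two terms therefore contribute at
  most \<open>K \<parallel>f\<parallel> \<parallel>g\<parallel> \<epsilon>\<close> each, and the last one at most \<open>K \<parallel>f\<parallel> \<parallel>g\<parallel> \<epsilon>\<^sup>2\<close>, which is the second-order term.

  The bound on \<open>y\<close> itself rests on two facts.  The Euclidean norm is submultiplicative for the
  entrywise product (\<open>norm_entrywise_times_le\<close>).  And the algorithm applies the transposes of
  \<open>A\<close> and \<open>B\<close>, whereas the estimate is in terms of \<open>\<parallel>A\<parallel>\<close> and \<open>\<parallel>B\<parallel>\<close>, so the spectral norm must not
  grow under transposition (\<open>norm_transpose_mult_le\<close>).\<close>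

lemma bounded_linear_complex_matrix:
  fixes M :: "complex ^ 'k ^ 'l"
  shows "bounded_linear (\<lambda>x. M *v x)"
proof -
  have "linear (\<lambda>x. M *v x)"
    by (rule linearI)
      (simp_all add: vec_eq_iff matrix_vector_mult_def scaleR_sum_right
        distrib_left sum.distrib)
  then show ?thesis
    by (simp add: linear_conv_bounded_linear)
qed

lemma norm_matrix_vector_mult_le:
  fixes M :: "complex ^ 'k ^ 'l"
  shows "norm (M *v x) \<le> spectral_norm M * norm x"
  unfolding spectral_norm_def by (rule onorm[OF bounded_linear_complex_matrix])

lemma spectral_norm_nonneg: "0 \<le> spectral_norm M"
  unfolding spectral_norm_def by (rule onorm_pos_le[OF bounded_linear_complex_matrix])

lemma norm_entrywise_times_le:
  fixes x y :: "'a::real_normed_algebra ^ 'k"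
  shows "norm (x * y) \<le> norm x * norm y"
proof -
  have "norm (x * y) \<le> L2_set (\<lambda>i. norm x * norm (y $ i)) UNIV"
    unfolding norm_vec_def[of "x * y"]
  proof (rule L2_set_mono)
    fix i
    show "norm ((x * y) $ i) \<le> norm x * norm (y $ i)"
      using norm_mult_ineq[of "x $ i" "y $ i"]
        mult_right_mono[OF Finite_Cartesian_Product.norm_nth_le[of x i] norm_ge_zero[of "y $ i"]]
      by simp
  qed simp
  also have "\<dots> = norm x * norm y"
    by (simp add: L2_set_right_distrib[symmetric] norm_vec_def[of y])
  finally show ?thesis .
qed

text \<open>Cauchy--Schwarz for the complex-bilinear dot product.\<close>

lemma norm_sum_mult_le:
  fixes x y :: "'a::real_normed_algebra ^ 'k"
  shows "norm (\<Sum>i\<in>UNIV. x $ i * y $ i) \<le> norm x * norm y"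
proof -
  have "norm (\<Sum>i\<in>UNIV. x $ i * y $ i) \<le> (\<Sum>i\<in>UNIV. \<bar>norm (x $ i)\<bar> * \<bar>norm (y $ i)\<bar>)"
    by (rule sum_norm_le) (simp add: norm_mult_ineq)
  also have "\<dots> \<le> norm x * norm y"
    unfolding norm_vec_def by (rule L2_set_mult_ineq)
  finally show ?thesis .
qed

text \<open>Let \<open>y = M\<^sup>T x\<close>.  Moving \<open>M\<close> to the other side of the dot product gives
  \<open>\<parallel>y\<parallel>\<^sup>2 = y \<cdot> cnj y = x \<cdot> M (cnj y) \<le> \<parallel>x\<parallel> \<parallel>M\<parallel> \<parallel>y\<parallel>\<close>, and one factor \<open>\<parallel>y\<parallel>\<close> cancels.\<close>

lemma norm_transpose_mult_le:
  fixes M :: "complex ^ 'k ^ 'l"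
  shows "norm (transpose M *v x) \<le> spectral_norm M * norm x"
proof -
  define y where "y = transpose M *v x"
  define z :: "complex ^ 'k" where "z = (\<chi> i. cnj (y $ i))"
  have norm_z: "norm z = norm y"
    by (simp add: norm_vec_def z_def)
  have "complex_of_real ((norm y)\<^sup>2) = (\<Sum>i\<in>UNIV. y $ i * z $ i)"
    unfolding norm_vec_def L2_set_def
    by (simp add: sum_nonneg z_def complex_norm_square[symmetric])
  also have "\<dots> = (\<Sum>i\<in>UNIV. \<Sum>j\<in>UNIV. M $ j $ i * x $ j * z $ i)"
    by (simp add: y_def matrix_vector_mult_def transpose_def sum_distrib_right)
  also have "\<dots> = (\<Sum>j\<in>UNIV. \<Sum>i\<in>UNIV. M $ j $ i * x $ j * z $ i)"
    by (rule sum.swap)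
  also have "\<dots> = (\<Sum>j\<in>UNIV. x $ j * (M *v z) $ j)"
    by (simp add: matrix_vector_mult_def sum_distrib_left mult_ac)
  finally have "(norm y)\<^sup>2 = norm (\<Sum>j\<in>UNIV. x $ j * (M *v z) $ j)"
    using norm_of_real[of "(norm y)\<^sup>2", where ?'a = complex] by simp
  also have "\<dots> \<le> norm x * norm (M *v z)"
    by (rule norm_sum_mult_le)
  also have "\<dots> \<le> norm x * (spectral_norm M * norm y)"
    using norm_matrix_vector_mult_le[of M z] by (simp add: norm_z mult_left_mono)
  finally have "norm y * norm y \<le> (spectral_norm M * norm x) * norm y"
    by (simp add: power2_eq_square mult_ac)
  then show ?thesis
    using mult_nonneg_nonneg[OF spectral_norm_nonneg[of M] norm_ge_zero[of x]]
    unfolding y_def[symmetric] by (cases "norm y = 0") (simp_all add: mult_le_cancel_right)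
qed

lemma complex_vec_add: "complex_vec (x + y) = complex_vec x + complex_vec y"
  by (simp add: complex_vec_def vec_eq_iff)

lemma norm_complex_vec: "norm (complex_vec x) = norm x"
  by (simp add: complex_vec_def norm_vec_def)

lemma norm_bilinear_alg_le:
  "norm (bilinear_alg A B C f g)
    \<le> spectral_norm C * spectral_norm A * spectral_norm B * norm f * norm g"
proof -
  let ?u = "transpose A *v complex_vec f" and ?v = "transpose B *v complex_vec g"
  have "norm (?u * ?v) \<le> norm ?u * norm ?v"
    by (rule norm_entrywise_times_le)
  also have "\<dots> \<le> (spectral_norm A * norm f) * (spectral_norm B * norm g)"
    using norm_transpose_mult_le[of A "complex_vec f"] norm_transpose_mult_le[of B "complex_vec g"]
    by (intro mult_mono) (simp_all add: norm_complex_vec spectral_norm_nonneg)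
  finally have "spectral_norm C * norm (?u * ?v)
      \<le> spectral_norm C * ((spectral_norm A * norm f) * (spectral_norm B * norm g))"
    by (intro mult_left_mono spectral_norm_nonneg)
  then show ?thesis
    using norm_matrix_vector_mult_le[of C "?u * ?v"]
    by (simp add: bilinear_alg_def mult_ac)
qed

lemma bilinear_alg_error_expand:
  "bilinear_alg_error A B C f g \<delta>f \<delta>g
    = bilinear_alg A B C f \<delta>g + bilinear_alg A B C \<delta>f g + bilinear_alg A B C \<delta>f \<delta>g"
  by (simp add: bilinear_alg_error_def bilinear_alg_def complex_vec_add
      matrix_vector_right_distrib distrib_left distrib_right)

theorem theorem9p1:
  fixes A :: "complex ^ 'R ^ 'r" and B :: "complex ^ 'R ^ 'n" and C :: "complex ^ 'R ^ 'm"
    and p :: "'r \<Rightarrow> nat" and q :: "'n \<Rightarrow> nat" and s :: "'m \<Rightarrow> nat"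
    and f :: "real ^ 'r" and g :: "real ^ 'n"
  assumes "numbering p" and "numbering q" and "numbering s"
    and "bilinear_alg_for_convolution p q s A B C"
  shows "\<exists>h \<in> O[at_right 0](\<lambda>\<epsilon>::real. \<epsilon> ^ 2). \<forall>\<epsilon>\<ge>0. \<forall>\<delta>f \<delta>g.
    norm \<delta>f \<le> \<epsilon> * norm f \<longrightarrow> norm \<delta>g \<le> \<epsilon> * norm g \<longrightarrow>
      norm (bilinear_alg_error A B C f g \<delta>f \<delta>g)
        \<le> 2 * (spectral_norm C * spectral_norm A * spectral_norm B * norm f * norm g) * \<epsilon> + h \<epsilon>"
proof -
  define K where "K = spectral_norm C * spectral_norm A * spectral_norm B"
  have K: "0 \<le> K"
    by (simp add: K_def spectral_norm_nonneg)
  have y_le: "norm (bilinear_alg A B C u v) \<le> K * (a * b)"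
    if "norm u \<le> a" "norm v \<le> b" for u v a b
  proof -
    have "norm (bilinear_alg A B C u v) \<le> K * (norm u * norm v)"
      using norm_bilinear_alg_le[of A B C u v] by (simp add: K_def mult_ac)
    also have "\<dots> \<le> K * (a * b)"
      using that K by (intro mult_left_mono mult_mono) (auto intro: order_trans[OF norm_ge_zero])
    finally show ?thesis .
  qed
  define h where "h = (\<lambda>\<epsilon>::real. K * norm f * norm g * \<epsilon> ^ 2)"
  show ?thesis
  proof (intro bexI[of _ h] allI impI)
    show "h \<in> O[at_right 0](\<lambda>\<epsilon>. \<epsilon> ^ 2)"
      unfolding h_def by simp
  next
    fix \<epsilon> :: real and \<delta>f :: "real ^ 'r" and \<delta>g :: "real ^ 'n"
    assume \<delta>f: "norm \<delta>f \<le> \<epsilon> * norm f" and \<delta>g: "norm \<delta>g \<le> \<epsilon> * norm g"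
    have "norm (bilinear_alg_error A B C f g \<delta>f \<delta>g)
        \<le> norm (bilinear_alg A B C f \<delta>g) + norm (bilinear_alg A B C \<delta>f g)
          + norm (bilinear_alg A B C \<delta>f \<delta>g)"
      unfolding bilinear_alg_error_expand by (intro norm_triangle_mono order_refl)
    also have "\<dots> \<le> K * (norm f * (\<epsilon> * norm g)) + K * (\<epsilon> * norm f * norm g)
          + K * (\<epsilon> * norm f * (\<epsilon> * norm g))"
      by (intro add_mono y_le order_refl \<delta>f \<delta>g)
    also have "\<dots> = 2 * (K * norm f * norm g) * \<epsilon> + h \<epsilon>"
      by (simp add: h_def power2_eq_square algebra_simps)
    finally show "norm (bilinear_alg_error A B C f g \<delta>f \<delta>g)
        \<le> 2 * (spectral_norm C * spectral_norm A * spectral_norm B * norm f * norm g) * \<epsilon> + h \<epsilon>"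
      unfolding K_def .
  qed
qed

end
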